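(* Let $\prec$ be a monomial ordering, let $F$ be a Gröbner basis (with respect to $\prec$) of an ideal $I$ of $\mathbb{Q}[X]$ and let $p$ be a prime number permissible for $(F,\prec)$. Let $U\subset X$ be such that $\mathrm{Ass}_U(I_p(F))$ is not empty, and let $\bar H$ be a Gröbner basis (with respect to $\prec$) of $$\bar J=\bigcap_{P_p\in \mathrm{Ass}_U(I_p(F))}P_p\subset \mathbb{F}_p[X].$$ Let $H_{can}\subset\mathbb{Q}[X]$ be a Gröbner basis candidate constructed from $\bar H$, i.e. a finite set, lifted from $\bar H$, for which $\phi_p(H_{can})=\bar H$; put $J=I(H_{can})$. Assume that $p$ is permissible for $(H_{can},\prec)$. Suppose that $H_{can}$ is a Gröbner basis of $J$ with respect to $\prec$, and that $p$ is effectively lucky for the reduced Gröbner basis $L$ of $(I:J)$ with respect to $\prec$, with $I_p(L)=(I_p(F):I_p(H_{can}))$. If $J$ is a radical ideal, then $J$ is an intersection of some prime divisors of $I$.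
   Context: $X=\{x_1,\ldots,x_n\}$ is a finite set of variables. For a prime number $p$, $\mathbb{Z}_{(p)}=\{a/b\in\mathbb{Q}\mid p\nmid b\}$ and $\phi_p:\mathbb{Z}_{(p)}[X]\to\mathbb{F}_p[X]$ is the canonical projection (reduction of coefficients modulo $p$). For $F\subset\mathbb{Q}[X]$, $I(F)$ is the ideal of $\mathbb{Q}[X]$ generated by $F$. For $F\subset \mathbb{Z}_{(p)}[X]$, $I_p(F)$ is the ideal of $\mathbb{F}_p[X]$ generated by $\phi_p(F)$. For ideals $A,B$ of a ring, $(A:B)=\{f\mid fB\subset A\}$. A prime $p$ is *permissible* for $(F,\prec)$ if $F\subset\mathbb{Z}_{(p)}[X]$ and $\phi_p(\mathrm{lc}_\prec(f))\neq 0$ for all $f\in F$, where $\mathrm{lc}_\prec(f)$ is the leading coefficient of $f$ with respect to $\prec$. A prime $p$ is *effectively lucky* for $F$ and $\prec$ if, with $G$ the reduced Gröbner basis of $I(F)$ with respect to $\prec$, $p$ is permissible for $(G,\prec)$ and $\phi_p(G)$ is the reduced Gröbner basis of $I_p(G)$. $\mathrm{Ass}(I)$ is the set of prime divisors (associated primes) of an ideal $I$. A subset $U\subset X$ is a *maximal independent set* (MIS) of a prime ideal $P\subset K[X]$ ($K$ a field) if $K[U]\cap P=\{0\}$ and $U$ is maximal with this property (equivalently $\#U=\dim K[X]/P$). For a subset $U\subset X$, $\mathrm{Ass}_U(I_p(F))=\{\bar P_p\in\mathrm{Ass}(I_p(F))\mid U \text{ is a MIS of } \bar P_p\}$. *)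

theory Defs
  imports
    "HOL-Library.Poly_Mapping"
    "Berlekamp_Zassenhaus.Finite_Field"
begin

text \<open>The variables are the elements of a finite type \<open>'x\<close>. A power product is an exponent
  vector, so multiplying power products is adding exponent vectors. The prime \<open>p\<close> is
  \<open>CARD('p)\<close> for a type \<open>'p\<close> of class \<^class>\<open>prime_card\<close>, and the field with \<open>p\<close> elements
  is \<open>'p mod_ring\<close>.\<close>

type_synonym 'x pp = "'x \<Rightarrow>\<^sub>0 nat"
type_synonym ('x, 'k) mpoly = "('x \<Rightarrow>\<^sub>0 nat) \<Rightarrow>\<^sub>0 'k"

text \<open>Ideals of a commutative ring are its submodules: \<open>ring_ideal.subspace I\<close> says that \<open>I\<close> is
  an ideal, \<open>ring_ideal.span F\<close> is the ideal generated by \<open>F\<close>.\<close>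

global_interpretation ring_ideal: Modules.module "(*) :: 'a::comm_ring_1 \<Rightarrow> 'a \<Rightarrow> 'a"
  by unfold_locales (simp_all add: algebra_simps)

definition ideal_quot :: "'a::comm_ring_1 set \<Rightarrow> 'a set \<Rightarrow> 'a set" where
  "ideal_quot A B = {f. \<forall>b\<in>B. f * b \<in> A}"

definition prime_ideal :: "'a::comm_ring_1 set \<Rightarrow> bool" where
  "prime_ideal P \<longleftrightarrow> ring_ideal.subspace P \<and> P \<noteq> UNIV \<and> (\<forall>a b. a * b \<in> P \<longrightarrow> a \<in> P \<or> b \<in> P)"

definition radical_ideal :: "'a::comm_ring_1 set \<Rightarrow> bool" where
  "radical_ideal I \<longleftrightarrow> ring_ideal.subspace I \<and> {f. \<exists>n. f ^ n \<in> I} = I"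

definition Ass :: "'a::comm_ring_1 set \<Rightarrow> 'a set set" where
  "Ass I = {P. prime_ideal P \<and> (\<exists>f. P = ideal_quot I {f})}"

definition monomial_ordering :: "'x pp rel \<Rightarrow> bool" where
  "monomial_ordering r \<longleftrightarrow> well_order r \<and> (\<forall>s t u. (s, t) \<in> r \<longrightarrow> (s + u, t + u) \<in> r)"

text \<open>The leading power product of \<open>0\<close> is unspecified, but its leading coefficient and leading
  term are \<open>0\<close>.\<close>

definition lpp :: "'x pp rel \<Rightarrow> ('x, 'k::zero) mpoly \<Rightarrow> 'x pp" where
  "lpp r f = (THE t. t \<in> Poly_Mapping.keys f \<and> (\<forall>s\<in>Poly_Mapping.keys f. (s, t) \<in> r))"

definition lc :: "'x pp rel \<Rightarrow> ('x, 'k::zero) mpoly \<Rightarrow> 'k" where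
  "lc r f = Poly_Mapping.lookup f (lpp r f)"

definition lt :: "'x pp rel \<Rightarrow> ('x, 'k::zero) mpoly \<Rightarrow> ('x, 'k) mpoly" where
  "lt r f = Poly_Mapping.single (lpp r f) (lc r f)"

definition groebner_basis ::
  "'x pp rel \<Rightarrow> ('x, 'k::field) mpoly set \<Rightarrow> ('x, 'k) mpoly set \<Rightarrow> bool" where
  "groebner_basis r G I \<longleftrightarrow>
     finite G \<and> G \<subseteq> I \<and> ring_ideal.span (lt r ` G) = ring_ideal.span (lt r ` I)"

definition reduced_groebner_basis ::
  "'x pp rel \<Rightarrow> ('x, 'k::field) mpoly set \<Rightarrow> ('x, 'k) mpoly set \<Rightarrow> bool" where
  "reduced_groebner_basis r G I \<longleftrightarrow>
     groebner_basis r G I \<and>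
     (\<forall>g\<in>G. lc r g = 1 \<and>
        (\<forall>t\<in>Poly_Mapping.keys g. Poly_Mapping.single t 1 \<notin> ring_ideal.span (lt r ` (G - {g}))))"

definition local_rats :: "nat \<Rightarrow> rat set" where
  "local_rats p = {of_int a / of_int b | a b. \<not> int p dvd b}"

definition local_polys :: "nat \<Rightarrow> ('x, rat) mpoly set" where
  "local_polys p = {f. \<forall>t. Poly_Mapping.lookup f t \<in> local_rats p}"

text \<open>Reduction modulo \<open>p\<close>, meaningful on \<^const>\<open>local_rats\<close> only; outside it, a denominator
  divisible by \<open>p\<close> gives the value \<open>0\<close>.\<close>

definition red :: "rat \<Rightarrow> 'p::prime_card mod_ring" where
  "red q = of_int (fst (quotient_of q)) / of_int (snd (quotient_of q))"

lemma red_of_int_divide: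
  assumes "\<not> int CARD('p::prime_card) dvd b"
  shows "(red (of_int a / of_int b) :: 'p mod_ring) = of_int a / of_int b"
proof -
  have z: "(of_int x :: 'p mod_ring) = 0 \<longleftrightarrow> int CARD('p) dvd x" for x
    by (simp add: of_int_eq_0_iff_char_dvd)
  obtain c d where q: "quotient_of (of_int a / of_int b) = (c, d)"
    by (meson surj_pair)
  have d: "d > 0" "coprime c d"
    using q quotient_of_denom_pos quotient_of_coprime by blast+
  have b: "b \<noteq> 0"
    using assms by auto
  have "(of_int a / of_int b :: rat) = of_int c / of_int d"
    using q quotient_of_div by blast
  then have "(of_int (a * d) :: rat) = of_int (c * b)"
    using d b by (simp add: field_simps)
  then have e: "a * d = c * b"
    using of_int_eq_iff by blast
  have "d dvd c * b"
    by (metis dvd_triv_right e)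
  then have "d dvd b"
    using d(2) by (simp add: coprime_dvd_mult_right_iff coprime_commute)
  then have "\<not> int CARD('p) dvd d"
    using assms dvd_trans[of "int CARD('p)" d b] by argo
  then have nz: "(of_int d :: 'p mod_ring) \<noteq> 0" "(of_int b :: 'p mod_ring) \<noteq> 0"
    using assms by (simp_all only: z not_False_eq_True)
  have "(of_int a * of_int d :: 'p mod_ring) = of_int c * of_int b"
    by (metis e of_int_mult)
  then show ?thesis
    by (simp only: red_def q fst_conv snd_conv frac_eq_eq[OF nz])
qed

definition phi :: "('x, rat) mpoly \<Rightarrow> ('x, 'p::prime_card mod_ring) mpoly" where
  "phi = Poly_Mapping.map red"

definition ideal_mod :: "('x, rat) mpoly set \<Rightarrow> ('x, 'p::prime_card mod_ring) mpoly set" where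
  "ideal_mod F = ring_ideal.span (phi ` F)"

definition permissible ::
  "'p::prime_card itself \<Rightarrow> 'x pp rel \<Rightarrow> ('x, rat) mpoly set \<Rightarrow> bool" where
  "permissible _ r F \<longleftrightarrow>
     F \<subseteq> local_polys CARD('p) \<and> (\<forall>f\<in>F. (red (lc r f) :: 'p mod_ring) \<noteq> 0)"

definition effectively_lucky ::
  "'p::prime_card itself \<Rightarrow> 'x pp rel \<Rightarrow> ('x, rat) mpoly set \<Rightarrow> bool" where
  "effectively_lucky p r F \<longleftrightarrow>
     (\<exists>G. reduced_groebner_basis r G (ring_ideal.span F) \<and> permissible p r G \<and>
        reduced_groebner_basis r (phi ` G :: ('x, 'p mod_ring) mpoly set) (ideal_mod G))"

definition polys_in :: "'x set \<Rightarrow> ('x, 'k::zero) mpoly set" where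
  "polys_in U = {f. \<forall>t\<in>Poly_Mapping.keys f. Poly_Mapping.keys t \<subseteq> U}"

definition independent_set :: "('x, 'k::field) mpoly set \<Rightarrow> 'x set \<Rightarrow> bool" where
  "independent_set P U \<longleftrightarrow> polys_in U \<inter> P = {0}"

definition maximal_independent_set :: "('x, 'k::field) mpoly set \<Rightarrow> 'x set \<Rightarrow> bool" where
  "maximal_independent_set P U \<longleftrightarrow>
     independent_set P U \<and> (\<forall>V. independent_set P V \<and> U \<subseteq> V \<longrightarrow> V = U)"

definition Ass_MIS :: "'x set \<Rightarrow> ('x, 'k::field) mpoly set \<Rightarrow> ('x, 'k) mpoly set set" where
  "Ass_MIS U I = {P \<in> Ass I. maximal_independent_set P U}"

end

theory Submission
  imports Defs
begin

text \<open>Put \<open>M = (I : L)\<close> with \<open>L = (I : J)\<close>, so that \<open>J \<subseteq> M\<close>. Since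
  \<open>M L \<subseteq> I\<close> and all the bases involved reduce well, the reduction of \<open>M \<inter> \<int>\<^bsub>(p)\<^esub>[X]\<close> lies in
  \<open>(I\<^sub>p(F) : (I\<^sub>p(F) : J\<^sub>p))\<close> with \<open>J\<^sub>p\<close> the intersection of the chosen associated primes of
  \<open>I\<^sub>p(F)\<close>, and this double quotient is \<open>J\<^sub>p\<close> itself. So a nonzero normal form of an element of \<open>M\<close>
  modulo the basis of \<open>J\<close> would, after scaling, reduce to a nonzero element of \<open>J\<^sub>p\<close> in normal form; hence
  \<open>M = J\<close>. As \<open>L\<close> is finitely generated, \<open>J = (I : L)\<close> gives \<open>Ass(J) \<subseteq> Ass(I)\<close>, and a
  radical ideal of a Noetherian ring is the intersection of its associated primes.\<close>

(* As a simp rule this associates products to the left and loops with mult.assoc. *)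
declare ring_ideal.scale_scale [simp del]

section \<open>Coefficients of reductions and of products with a single term\<close>

lemma lookup_phi: "Poly_Mapping.lookup (phi f) t = red (Poly_Mapping.lookup f t)"
  by (simp add: phi_def Poly_Mapping.map.rep_eq when_def red_def)

lemma sum_single_lookup:
  "(\<Sum>k\<in>Poly_Mapping.keys f. Poly_Mapping.single k (Poly_Mapping.lookup f k)) = f"
  by (rule poly_mapping_eqI)
    (auto simp: lookup_sum lookup_single when_def in_keys_iff sum.delta)

lemma single_times:
  fixes f :: "('x, 'k::comm_ring_1) mpoly"
  shows "Poly_Mapping.single u c * f =
    (\<Sum>k\<in>Poly_Mapping.keys f. Poly_Mapping.single (u + k) (c * Poly_Mapping.lookup f k))"
  by (subst (1) sum_single_lookup[of f, symmetric]) (simp add: sum_distrib_left mult_single)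

lemma lookup_single_times_add:
  fixes f :: "('x, 'k::comm_ring_1) mpoly"
  shows "Poly_Mapping.lookup (Poly_Mapping.single u c * f) (u + t) = c * Poly_Mapping.lookup f t"
  by (auto simp: single_times lookup_sum lookup_single when_def in_keys_iff sum.delta)

lemma lookup_single_times_other:
  fixes f :: "('x, 'k::comm_ring_1) mpoly"
  assumes "\<nexists>s. t = u + s"
  shows "Poly_Mapping.lookup (Poly_Mapping.single u c * f) t = 0"
  using assms by (auto simp: single_times lookup_sum lookup_single when_def intro!: sum.neutral)

lemma scalar_times:
  fixes f :: "('x, 'k::comm_ring_1) mpoly"
  shows "Poly_Mapping.lookup (Poly_Mapping.single 0 c * f) t = c * Poly_Mapping.lookup f t"
  using lookup_single_times_add[of 0 c f t] by simp

subsection \<open>Leading power products and normal forms\<close>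

lemma
  assumes "monomial_ordering r"
  shows ord_total: "(s, t) \<in> r \<or> (t, s) \<in> r"
    and ord_antisym: "(s, t) \<in> r \<Longrightarrow> (t, s) \<in> r \<Longrightarrow> s = t"
    and ord_trans: "(s, t) \<in> r \<Longrightarrow> (t, u) \<in> r \<Longrightarrow> (s, u) \<in> r"
    and ord_refl: "(s, s) \<in> r"
    and ord_add: "(s, t) \<in> r \<Longrightarrow> (s + u, t + u) \<in> r"
    and ord_wf: "wf (r - Id)"
  using assms
  unfolding monomial_ordering_def well_order_on_def linear_order_on_def partial_order_on_def
    preorder_on_def total_on_def refl_on_def
  by (metis UNIV_I, metis antisymD, metis transD, blast, blast, blast)

text \<open>\<open>monomial_ordering\<close> has no clause making \<open>0\<close> least; that comes
  from well-foundedness, since otherwise \<open>s\<close>, \<open>s + u\<close>,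
  \<open>s + u + u\<close>, ... would descend forever.\<close>

lemma ord_le_add:
  assumes ord: "monomial_ordering r"
  shows "(s, s + u) \<in> r"
proof (rule ccontr)
  assume neg: "(s, s + u) \<notin> r"
  obtain m where m: "m \<in> range (\<lambda>n. ((+) u ^^ n) s)"
    and min: "\<And>y. (y, m) \<in> r - Id \<Longrightarrow> y \<notin> range (\<lambda>n. ((+) u ^^ n) s)"
    using wfE_min[OF ord_wf[OF ord], of s "range (\<lambda>n. ((+) u ^^ n) s)"]
    by (metis (no_types, lifting) funpow_0 rangeI)
  have dec: "(((+) u ^^ Suc n) s, ((+) u ^^ n) s) \<in> r - Id" for n
  proof (induction n)
    case 0
    then show ?case
      using neg ord_total[OF ord, of s "s + u"] ord_refl[OF ord] by (auto simp: add.commute)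
  next
    case (Suc n)
    then show ?case
      using ord_add[OF ord, of "((+) u ^^ Suc n) s" "((+) u ^^ n) s" u]
      by (simp add: add.commute[of _ u])
  qed
  then show False
    using m min by (metis (no_types, lifting) rangeE rangeI)
qed

lemma lpp_in_keys_max:
  fixes f :: "('x, 'k::zero) mpoly"
  assumes ord: "monomial_ordering r" and "f \<noteq> 0"
  shows "lpp r f \<in> Poly_Mapping.keys f \<and> (\<forall>s\<in>Poly_Mapping.keys f. (s, lpp r f) \<in> r)"
proof -
  have "\<exists>t\<in>S. \<forall>s\<in>S. (s, t) \<in> r" if "finite S" "S \<noteq> {}" for S
    using that
  proof (induction S rule: finite_ne_induct)
    case (singleton x)
    then show ?case
      using ord_refl[OF ord] by simp
  next
    case (insert x S)
    then obtain t where t: "t \<in> S" "\<forall>s\<in>S. (s, t) \<in> r"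
      by blast
    show ?case
      using t ord_total[OF ord, of x t] ord_trans[OF ord] ord_refl[OF ord] by (metis insert_iff)
  qed
  then obtain t where t: "t \<in> Poly_Mapping.keys f" "\<forall>s\<in>Poly_Mapping.keys f. (s, t) \<in> r"
    using \<open>f \<noteq> 0\<close> by (metis finite_keys keys_eq_empty poly_mapping_eqI in_keys_iff lookup_zero empty_iff)
  then show ?thesis
    unfolding lpp_def by (rule_tac theI) (use ord_antisym[OF ord] in blast)+
qed

lemma
  fixes f :: "('x, 'k::zero) mpoly"
  assumes "monomial_ordering r" and "f \<noteq> 0"
  shows lpp_in_keys: "lpp r f \<in> Poly_Mapping.keys f"
    and lpp_max: "s \<in> Poly_Mapping.keys f \<Longrightarrow> (s, lpp r f) \<in> r"
    and lc_nonzero: "lc r f \<noteq> 0"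
  using lpp_in_keys_max[OF assms] by (simp_all add: lc_def in_keys_iff)

lemma lpp_eqI:
  fixes f :: "('x, 'k::zero) mpoly"
  assumes "monomial_ordering r" "t \<in> Poly_Mapping.keys f"
    and "\<And>s. s \<in> Poly_Mapping.keys f \<Longrightarrow> (s, t) \<in> r"
  shows "lpp r f = t"
  using assms lpp_in_keys_max[OF assms(1), of f] ord_antisym[OF assms(1)]
  by (metis empty_iff keys_zero)

lemma lpp_less:
  fixes f :: "('x, 'k::zero) mpoly"
  assumes "monomial_ordering r" "f \<noteq> 0" "Poly_Mapping.lookup f t = 0"
    and "\<And>s. s \<in> Poly_Mapping.keys f \<Longrightarrow> (s, t) \<in> r"
  shows "(lpp r f, t) \<in> r - Id"
  using assms lpp_in_keys[OF assms(1,2)] by (auto simp: in_keys_iff)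

text \<open>The factor makes the two leading terms cancel, and compatibility with addition keeps the
  shifted \<open>g\<close> below. This drives both division and the chain condition.\<close>

lemma lpp_cancel:
  fixes f g :: "('x, 'k::field) mpoly"
  assumes ord: "monomial_ordering r" and "f \<noteq> 0" "g \<noteq> 0" and eq: "lpp r f = lpp r g + u"
    and h: "h = f - Poly_Mapping.single u (lc r f / lc r g) * g" and "h \<noteq> 0"
  shows "(lpp r h, lpp r f) \<in> r - Id"
proof (rule lpp_less[OF ord \<open>h \<noteq> 0\<close>])
  show "Poly_Mapping.lookup h (lpp r f) = 0"
    using lc_nonzero[OF ord \<open>g \<noteq> 0\<close>] lookup_single_times_add[of u "lc r f / lc r g" g "lpp r g"]
    by (simp add: h lookup_minus eq add.commute[of "lpp r g"] lc_def)
next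
  fix s
  assume "s \<in> Poly_Mapping.keys h"
  then consider "s \<in> Poly_Mapping.keys f"
    | "s \<in> Poly_Mapping.keys (Poly_Mapping.single u (lc r f / lc r g) * g)"
    using keys_diff[of f "Poly_Mapping.single u (lc r f / lc r g) * g"]
    by (auto simp: h in_keys_iff lookup_minus)
  then show "(s, lpp r f) \<in> r"
  proof cases
    case 2
    then obtain s' where "s = u + s'" "s' \<in> Poly_Mapping.keys g"
      using keys_mult[of "Poly_Mapping.single u (lc r f / lc r g)" g]
      by (auto split: if_splits)
    then show ?thesis
      using lpp_max[OF ord \<open>g \<noteq> 0\<close>] ord_add[OF ord] by (metis add.commute eq)
  qed (rule lpp_max[OF ord \<open>f \<noteq> 0\<close>])
qed

text \<open>Every key has to be irreducible, not only the leading one. Zero elements of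
  \<open>G\<close> are skipped because their \<open>lpp\<close> is unspecified.\<close>

definition normal_form :: "'x pp rel \<Rightarrow> ('x, 'k::zero) mpoly set \<Rightarrow> ('x, 'k) mpoly \<Rightarrow> bool" where
  "normal_form r G f \<longleftrightarrow>
     (\<forall>t\<in>Poly_Mapping.keys f. \<forall>g\<in>G. g \<noteq> 0 \<longrightarrow> (\<nexists>u. t = lpp r g + u))"

text \<open>The coefficients are restricted to a subring \<open>A\<close> in order to divide over \<open>\<int>\<^bsub>(p)\<^esub>\<close>; the predicate
  \<open>Q\<close> stands for membership in the \<open>A\<close>-linear combinations of multiples of \<open>G\<close>.\<close>

lemma division:
  fixes f :: "('x, 'k::field) mpoly" and A :: "'k set"
  assumes ord: "monomial_ordering r"
    and A: "\<And>a b. a \<in> A \<Longrightarrow> b \<in> A \<Longrightarrow> a * b \<in> A" "\<And>a b. a \<in> A \<Longrightarrow> b \<in> A \<Longrightarrow> a - b \<in> A"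
    and G: "\<And>g t. g \<in> G \<Longrightarrow> Poly_Mapping.lookup g t \<in> A"
      "\<And>g. g \<in> G \<Longrightarrow> g \<noteq> 0 \<Longrightarrow> inverse (lc r g) \<in> A"
    and Q: "Q 0" "\<And>x y. Q x \<Longrightarrow> Q y \<Longrightarrow> Q (x + y)"
      "\<And>u a g. a \<in> A \<Longrightarrow> g \<in> G \<Longrightarrow> Q (Poly_Mapping.single u a * g)"
    and f: "\<And>t. Poly_Mapping.lookup f t \<in> A"
  shows "\<exists>q. Q q \<and> normal_form r G (f - q)"
proof -
  have main: "\<exists>q. Q q \<and> normal_form r G (f - q)"
    if "\<And>t. Poly_Mapping.lookup f t \<in> A" "f \<noteq> 0" "lpp r f = t" for f t
    using ord_wf[OF ord] that
  proof (induction t arbitrary: f rule: wf_induct_rule)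
    case (less t)
    have A0: "0 \<in> A"
      using A(2)[OF less(2)[of t] less(2)[of t]] by simp
    have IH: "\<exists>q. Q q \<and> normal_form r G (h - q)"
      if "\<And>t. Poly_Mapping.lookup h t \<in> A" "h \<noteq> 0 \<Longrightarrow> (lpp r h, lpp r f) \<in> r - Id" for h
    proof (cases "h = 0")
      case True
      then show ?thesis
        by (intro exI[of _ 0]) (simp add: Q(1) normal_form_def)
    next
      case False
      then show ?thesis
        using that(2)[OF False] less.prems(3) less.IH[OF _ that(1) False refl] by simp
    qed
    show ?case
    proof (cases "\<exists>g\<in>G. g \<noteq> 0 \<and> (\<exists>u. lpp r f = lpp r g + u)")
      case True
      then obtain g u where g: "g \<in> G" "g \<noteq> 0" "lpp r f = lpp r g + u"
        by blast
      define q where "q = Poly_Mapping.single u (lc r f / lc r g) * g"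
      have a: "lc r f / lc r g \<in> A"
        using A(1)[OF less(2) G(2)[OF g(1,2)]] by (simp add: lc_def divide_inverse)
      have "Poly_Mapping.lookup q s \<in> A" for s
        using lookup_single_times_add[of u "lc r f / lc r g" g]
          lookup_single_times_other[of s u "lc r f / lc r g" g] A0 A(1)[OF a G(1)[OF g(1)]]
        by (metis q_def)
      then have "Poly_Mapping.lookup (f - q) s \<in> A" for s
        using A(2) less.prems(1) by (simp add: lookup_minus)
      then obtain q' where "Q q'" "normal_form r G (f - q - q')"
        using IH[of "f - q"] lpp_cancel[OF ord less.prems(2) g(2,3)] q_def by blast
      then show ?thesis
        using Q(2)[OF Q(3)[OF a g(1)]] by (metis diff_diff_eq q_def)
    next
      case False
      \<comment> \<open>An irreducible leading term goes to the remainder, and the rest is divided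
        instead.\<close>
      define h where "h = f - lt r f"
      have "Poly_Mapping.lookup h s \<in> A" for s
        using less.prems(1) A0 by (auto simp: h_def lookup_minus lt_def lookup_single when_def lc_def)
      moreover have "(lpp r h, lpp r f) \<in> r - Id" if "h \<noteq> 0"
        by (rule lpp_less[OF ord that])
          (use lpp_max[OF ord less.prems(2)] in \<open>auto simp: h_def lookup_minus lt_def lookup_single
            when_def lc_def in_keys_iff split: if_splits\<close>)
      ultimately obtain q where q: "Q q" "normal_form r G (h - q)"
        using IH[of h] by blast
      have "t' \<in> Poly_Mapping.keys (h - q)"
        if "t' \<in> Poly_Mapping.keys (f - q)" "t' \<noteq> lpp r f" for t'
        using that by (simp add: h_def lookup_minus lt_def lookup_single_not_eq in_keys_iff)
      then have "normal_form r G (f - q)"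
        using q(2) False unfolding normal_form_def by metis
      then show ?thesis
        using q(1) by blast
    qed
  qed
  show ?thesis
  proof (cases "f = 0")
    case True
    then show ?thesis
      by (intro exI[of _ 0]) (simp add: Q(1) normal_form_def)
  qed (use main f in blast)
qed

subsection \<open>Groebner bases\<close>

text \<open>Multiplying a term by a polynomial yields only multiples of that term, and addition
  creates no new keys. A zero \<open>g\<close> contributes nothing, as
  \<open>lt r g = 0\<close>.\<close>

lemma keys_in_span_lt:
  fixes f :: "('x, 'k::field) mpoly"
  assumes "f \<in> ring_ideal.span (lt r ` G)" "t \<in> Poly_Mapping.keys f"
  shows "\<exists>g\<in>G. g \<noteq> 0 \<and> (\<exists>u. t = lpp r g + u)"
proof -
  let ?T = "{t. \<exists>g\<in>G. g \<noteq> 0 \<and> (\<exists>u. t = lpp r g + u)}"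
  have "Poly_Mapping.keys f \<subseteq> ?T"
    using assms(1)
  proof (induction rule: ring_ideal.span_induct_alt)
    case (step c x y)
    then obtain g where g: "g \<in> G" "x = lt r g"
      by blast
    have "Poly_Mapping.keys (c * x) \<subseteq> ?T"
    proof
      fix t
      assume "t \<in> Poly_Mapping.keys (c * x)"
      then obtain u v where "t = u + v" "v \<in> Poly_Mapping.keys x"
        using keys_mult[of c x] by blast
      then have "t = lpp r g + u" "g \<noteq> 0"
        using g by (auto simp: lt_def lc_def add.commute split: if_splits)
      then show "t \<in> ?T"
        using g by blast
    qed
    then show ?case
      using step keys_add[of "c * x" y] by blast
  qed simp
  then show ?thesis
    using assms(2) by blast
qed

lemma groebner_basis_lpp:
  fixes f :: "('x, 'k::field) mpoly"
  assumes "monomial_ordering r" "groebner_basis r G I" "f \<in> I" "f \<noteq> 0"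
  shows "\<exists>g\<in>G. g \<noteq> 0 \<and> (\<exists>u. lpp r f = lpp r g + u)"
proof (rule keys_in_span_lt)
  show "lt r f \<in> ring_ideal.span (lt r ` G)"
    using assms by (auto simp: groebner_basis_def intro: ring_ideal.span_base)
  show "lpp r f \<in> Poly_Mapping.keys (lt r f)"
    using lc_nonzero[OF assms(1,4)] by (simp add: lt_def)
qed

lemma normal_form_in_ideal:
  fixes f :: "('x, 'k::field) mpoly"
  assumes "monomial_ordering r" "groebner_basis r G I" "f \<in> I" "normal_form r G f"
  shows "f = 0"
  using groebner_basis_lpp[OF assms(1-3)] lpp_in_keys[OF assms(1)] assms(4)
  unfolding normal_form_def by blast

lemma division_field:
  fixes f :: "('x, 'k::field) mpoly"
  assumes "monomial_ordering r"
  shows "\<exists>q\<in>ring_ideal.span G. normal_form r G (f - q)"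
  using division[OF assms, of UNIV G "\<lambda>q. q \<in> ring_ideal.span G" f]
  by (auto intro: ring_ideal.span_zero ring_ideal.span_add ring_ideal.span_scale ring_ideal.span_base)

text \<open>Groebner bases are defined through leading terms, so generation is derived: the
  remainder of an element of \<open>I\<close> is a normal form inside \<open>I\<close>, hence
  \<open>0\<close>.\<close>

lemma groebner_basis_span:
  fixes I :: "('x, 'k::field) mpoly set"
  assumes "monomial_ordering r" "ring_ideal.subspace I" "groebner_basis r G I"
  shows "ring_ideal.span G = I"
proof
  show sub: "ring_ideal.span G \<subseteq> I"
    using assms by (simp add: groebner_basis_def ring_ideal.span_minimal)
  show "I \<subseteq> ring_ideal.span G"
  proof
    fix f
    assume "f \<in> I"
    obtain q where q: "q \<in> ring_ideal.span G" "normal_form r G (f - q)"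
      using division_field[OF assms(1)] by blast
    have "f - q \<in> I"
      using \<open>f \<in> I\<close> q sub assms(2) by (meson ring_ideal.subspace_diff subsetD)
    then show "f \<in> ring_ideal.span G"
      using normal_form_in_ideal[OF assms(1,3) _ q(2)] q(1) by simp
  qed
qed

text \<open>As \<open>g'\<close> is monic, a suitable multiple of \<open>lt r g'\<close> is exactly
  \<open>single t 1\<close>, which reducedness keeps out of the span.\<close>

lemma reduced_groebner_basis_keys:
  fixes G :: "('x, 'k::field) mpoly set"
  assumes ord: "monomial_ordering r" and G: "reduced_groebner_basis r G I"
    and g: "g \<in> G" "g' \<in> G" "g' \<noteq> 0" "g' \<noteq> g" and t: "t \<in> Poly_Mapping.keys g"
  shows "t \<noteq> lpp r g' + u"
proof
  assume eq: "t = lpp r g' + u"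
  have "lt r g' \<in> lt r ` (G - {g})"
    using g by blast
  then have "Poly_Mapping.single u 1 * lt r g' \<in> ring_ideal.span (lt r ` (G - {g}))"
    by (intro ring_ideal.span_scale ring_ideal.span_base)
  moreover have "Poly_Mapping.single u 1 * lt r g' = Poly_Mapping.single t 1"
    using G g by (simp add: lt_def mult_single eq add.commute reduced_groebner_basis_def)
  ultimately show False
    using G g t by (auto simp: reduced_groebner_basis_def)
qed

text \<open>One half of the uniqueness of reduced bases. \<open>effectively_lucky\<close> only
  provides some reduced basis, which this links to a given one.\<close>

lemma reduced_groebner_basis_subset:
  fixes G :: "('x, 'k::field) mpoly set"
  assumes ord: "monomial_ordering r" and I: "ring_ideal.subspace I"
    and G: "reduced_groebner_basis r G I" and L: "reduced_groebner_basis r L I"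
  shows "G \<subseteq> L"
proof
  fix g
  assume g: "g \<in> G"
  have gbG: "groebner_basis r G I" and gbL: "groebner_basis r L I"
    and monic: "\<And>g. g \<in> G \<Longrightarrow> lc r g = 1" "\<And>g. g \<in> L \<Longrightarrow> lc r g = 1"
    using G L by (auto simp: reduced_groebner_basis_def)
  have "g \<noteq> 0"
    using monic(1)[OF g] by (auto simp: lc_def)
  have gI: "g \<in> I"
    using gbG g by (auto simp: groebner_basis_def)
  obtain l u where l: "l \<in> L" "l \<noteq> 0" and u: "lpp r g = lpp r l + u"
    using groebner_basis_lpp[OF ord gbL gI \<open>g \<noteq> 0\<close>] by blast
  have lI: "l \<in> I"
    using gbL l by (auto simp: groebner_basis_def)
  obtain g' v where g': "g' \<in> G" "g' \<noteq> 0" and v: "lpp r l = lpp r g' + v"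
    using groebner_basis_lpp[OF ord gbG lI l(2)] by blast
  \<comment> \<open>\<open>lpp r g\<close> is a multiple of \<open>lpp r g'\<close>, so reducedness
    of \<open>G\<close> leaves only \<open>g' = g\<close>; then \<open>v + u = 0\<close> with
    natural exponents.\<close>
  have "g' = g"
    using reduced_groebner_basis_keys[OF ord G g g'(1,2) _ lpp_in_keys[OF ord \<open>g \<noteq> 0\<close>], of "v + u"]
    by (auto simp: u v add.assoc)
  then have "lpp r g + (v + u) = lpp r g + 0"
    using u v by (simp add: add.assoc)
  then have vu: "v + u = 0"
    by (simp only: add_left_cancel)
  then have "Poly_Mapping.lookup u x = 0" for x
    by (metis add_is_0 lookup_add lookup_zero)
  then have "u = 0"
    by (simp add: poly_mapping_eqI)
  then have same: "lpp r g = lpp r l"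
    using u by simp
  \<comment> \<open>The monic leading terms cancel. The leading key of a nonzero difference would be
    a key of \<open>g\<close> or \<open>l\<close> divisible by the leading power product of another
    element of the same basis.\<close>
  have "g - l = 0"
  proof (rule ccontr)
    assume nz: "g - l \<noteq> 0"
    have dI: "g - l \<in> I"
      using gI lI I by (rule_tac ring_ideal.subspace_diff)
    have in_keys: "lpp r (g - l) \<in> Poly_Mapping.keys g \<union> Poly_Mapping.keys l"
      using lpp_in_keys[OF ord nz] by (auto simp: in_keys_iff lookup_minus)
    have "(lpp r (g - l), lpp r g) \<in> r - Id"
    proof (rule lpp_less[OF ord nz])
      show "Poly_Mapping.lookup (g - l) (lpp r g) = 0"
        using monic(1)[OF g] monic(2)[OF l(1)] by (simp add: lookup_minus lc_def same)
      show "(s, lpp r g) \<in> r" if "s \<in> Poly_Mapping.keys (g - l)" for s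
        using that lpp_max[OF ord \<open>g \<noteq> 0\<close>] lpp_max[OF ord \<open>l \<noteq> 0\<close>] same
        by (cases "s \<in> Poly_Mapping.keys g") (auto simp: in_keys_iff lookup_minus)
    qed
    then have less: "(lpp r (g - l), lpp r g) \<in> r" "lpp r (g - l) \<noteq> lpp r g"
      by auto
    have pos: "(lpp r h, lpp r h + w) \<in> r" for h :: "('x, 'k) mpoly" and w
      by (rule ord_le_add[OF ord])
    obtain h w where h: "h \<in> G" "h \<noteq> 0" "lpp r (g - l) = lpp r h + w"
      using groebner_basis_lpp[OF ord gbG dI nz] by blast
    obtain h' w' where h': "h' \<in> L" "h' \<noteq> 0" "lpp r (g - l) = lpp r h' + w'"
      using groebner_basis_lpp[OF ord gbL dI nz] by blast
    have "h \<noteq> g" "h' \<noteq> l"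
      using pos[of h w] pos[of h' w'] less h(3) h'(3) same ord_antisym[OF ord] by metis+
    then show False
      using in_keys h h' reduced_groebner_basis_keys[OF ord G g h(1,2)]
        reduced_groebner_basis_keys[OF ord L l(1) h'(1,2)] by blast
  qed
  then show "g \<in> L"
    using l by simp
qed


subsection \<open>The ascending chain condition\<close>

text \<open>A decreasing sequence of naturals is constant from the point where it attains its
  minimum.\<close>

lemma mono_subsequence:
  fixes s :: "nat \<Rightarrow> nat"
  shows "\<exists>f :: nat \<Rightarrow> nat. strict_mono f \<and> mono (\<lambda>n. s (f n))"
proof -
  obtain f where f: "strict_mono f" "monoseq (\<lambda>n. s (f n))"
    using seq_monosub[of s] by blast
  show ?thesis
  proof (cases "mono (\<lambda>n. s (f n))")
    case True
    then show ?thesis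
      using f by blast
  next
    case False
    then have dec: "antimono (\<lambda>n. s (f n))"
      using f(2) by (simp add: monoseq_iff)
    obtain m where m: "\<And>n. s (f m) \<le> s (f n)"
      using ex_has_least_nat[of "\<lambda>_. True" 0 "\<lambda>n. s (f n)"] by blast
    have "s (f (m + n)) = s (f m)" for n
      using m[of "m + n"] antimonoD[OF dec, of m "m + n"] by simp
    then have "mono (\<lambda>n. s (f (m + n)))"
      by (simp add: mono_def)
    moreover have "strict_mono (\<lambda>n. f (m + n))"
      using f(1) by (simp add: strict_mono_def)
    ultimately show ?thesis
      by blast
  qed
qed

text \<open>Dickson's lemma, by thinning out to a subsequence monotone in one variable after
  another.\<close>

lemma dickson:
  fixes f :: "nat \<Rightarrow> ('x::finite) pp"
  shows "\<exists>i j u. i < j \<and> f j = f i + u"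
proof -
  have "\<exists>g :: nat \<Rightarrow> nat. strict_mono g \<and> (\<forall>x\<in>X. mono (\<lambda>n. Poly_Mapping.lookup (f (g n)) x))" for X :: "'x set"
    using finite[of X]
  proof (induction X rule: finite_induct)
    case empty
    then show ?case
      using strict_mono_id by auto
  next
    case (insert x X)
    then obtain g :: "nat \<Rightarrow> nat" where g: "strict_mono g" "\<forall>x\<in>X. mono (\<lambda>n. Poly_Mapping.lookup (f (g n)) x)"
      by blast
    obtain h :: "nat \<Rightarrow> nat" where h: "strict_mono h" "mono (\<lambda>n. Poly_Mapping.lookup (f (g (h n))) x)"
      using mono_subsequence[of "\<lambda>n. Poly_Mapping.lookup (f (g n)) x"] by blast
    have "mono (\<lambda>n. Poly_Mapping.lookup (f (g (h n))) y)" if "y \<in> X" for y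
      using g(2) that strict_mono_mono[OF h(1)] by (simp add: mono_def)
    then show ?case
      using h strict_mono_o[OF g(1) h(1)]
      by (intro exI[of _ "\<lambda>n. g (h n)"]) (auto simp: o_def)
  qed
  then obtain g :: "nat \<Rightarrow> nat" where g: "strict_mono g"
    "\<And>x. mono (\<lambda>n. Poly_Mapping.lookup (f (g n)) x)"
    by (metis UNIV_I)
  have "Poly_Mapping.lookup (f (g 0)) x \<le> Poly_Mapping.lookup (f (g 1)) x" for x
    using monoD[OF g(2), of 0 1] by simp
  \<comment> \<open>Subtraction of exponents truncates, but is exact here by the inequality in each
    variable.\<close>
  then have "f (g 1) = f (g 0) + (f (g 1) - f (g 0))"
    by (intro poly_mapping_eqI) (simp add: lookup_add lookup_minus)
  moreover have "g 0 < g 1"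
    using g(1) by (simp add: strict_mono_def)
  ultimately show ?thesis
    by blast
qed

text \<open>The polynomial ring is Noetherian: let \<open>f k\<close> have the least leading power
  product among the new elements of \<open>I (Suc k)\<close>. By Dickson's lemma some
  \<open>f i\<close> reduces a later \<open>f j\<close> to a smaller new element.\<close>

lemma no_ascending_chain:
  fixes I :: "nat \<Rightarrow> ('x::finite, 'k::field) mpoly set" and r :: "'x pp rel"
  assumes ord: "monomial_ordering r" and ideal: "\<And>k. ring_ideal.subspace (I k)"
    and chain: "\<And>k. I k \<subset> I (Suc k)"
  shows False
proof -
  have "\<exists>f\<in>I (Suc k) - I k. \<forall>h\<in>I (Suc k) - I k. (lpp r h, lpp r f) \<notin> r - Id" for k
  proof -
    obtain f0 where "f0 \<in> I (Suc k) - I k"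
      using chain[of k] by blast
    then obtain t where "t \<in> lpp r ` (I (Suc k) - I k)"
      "\<And>y. (y, t) \<in> r - Id \<Longrightarrow> y \<notin> lpp r ` (I (Suc k) - I k)"
      using wfE_min[OF ord_wf[OF ord], of "lpp r f0" "lpp r ` (I (Suc k) - I k)"] by blast
    then show ?thesis
      by blast
  qed
  then obtain f where f: "\<And>k. f k \<in> I (Suc k) - I k"
    "\<And>k h. h \<in> I (Suc k) - I k \<Longrightarrow> (lpp r h, lpp r (f k)) \<notin> r - Id"
    by metis
  obtain i j u where ij: "i < j" "lpp r (f j) = lpp r (f i) + u"
    using dickson[of "\<lambda>k. lpp r (f k)"] by blast
  have nz: "f k \<noteq> 0" for k
    using f(1)[of k] ring_ideal.subspace_0[OF ideal] by fastforce
  define q where "q = Poly_Mapping.single u (lc r (f j) / lc r (f i)) * f i"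
  have "I (Suc i) \<subseteq> I j"
    by (rule lift_Suc_mono_le[of I]) (use chain ij in \<open>auto simp: psubset_eq\<close>)
  then have qI: "q \<in> I j"
    using f(1)[of i] ideal by (auto simp: q_def intro: ring_ideal.subspace_scale)
  have "f j - q \<in> I (Suc j) - I j"
  proof -
    have "q \<in> I (Suc j)"
      using qI chain[of j] by blast
    then have "f j - q \<in> I (Suc j)"
      using f(1)[of j] ideal by (auto intro: ring_ideal.subspace_diff)
    moreover have "f j - q \<notin> I j"
      using f(1)[of j] qI ring_ideal.subspace_add[OF ideal, of "f j - q" j q] by auto
    ultimately show ?thesis
      by blast
  qed
  moreover from this have "f j - q \<noteq> 0"
    using ring_ideal.subspace_0[OF ideal] by fastforce
  ultimately show False
    using f(2) lpp_cancel[OF ord nz nz ij(2) q_def[THEN arg_cong[where f = "\<lambda>q. f j - q"]]] by blast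
qed

subsection \<open>Associated primes\<close>

lemma ideal_quot_singleton [simp]: "x \<in> ideal_quot I {f} \<longleftrightarrow> x * f \<in> I"
  by (simp add: ideal_quot_def)

lemma subspace_ideal_quot:
  assumes "ring_ideal.subspace I"
  shows "ring_ideal.subspace (ideal_quot I B)"
proof (rule ring_ideal.subspaceI)
  show "0 \<in> ideal_quot I B"
    using ring_ideal.subspace_0[OF assms] by (simp add: ideal_quot_def)
next
  fix x y
  assume "x \<in> ideal_quot I B" "y \<in> ideal_quot I B"
  then have "x * b + y * b \<in> I" if "b \<in> B" for b
    using that by (intro ring_ideal.subspace_add[OF assms]) (auto simp: ideal_quot_def)
  then show "x + y \<in> ideal_quot I B"
    by (simp add: ideal_quot_def distrib_right)
next
  fix c x
  assume "x \<in> ideal_quot I B"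
  then have "c * (x * b) \<in> I" if "b \<in> B" for b
    using that by (rule_tac ring_ideal.subspace_scale[OF assms]) (simp add: ideal_quot_def)
  then show "c * x \<in> ideal_quot I B"
    by (simp add: ideal_quot_def mult.assoc)
qed

text \<open>A maximal element among the proper quotients \<open>(J : g h)\<close> is a prime avoiding \<open>g\<close>.\<close>

lemma radical_ideal_Ass:
  fixes J :: "'a::comm_ring_1 set"
  assumes acc: "\<And>I :: nat \<Rightarrow> 'a set.
      (\<And>k. ring_ideal.subspace (I k)) \<Longrightarrow> (\<And>k. I k \<subset> I (Suc k)) \<Longrightarrow> False"
    and rad: "radical_ideal J" and g: "g \<notin> J"
  shows "\<exists>Q\<in>Ass J. g \<notin> Q"
proof -
  have J: "ring_ideal.subspace J"
    and closed: "{f. \<exists>n. f ^ n \<in> J} = J"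
    using rad by (simp_all only: radical_ideal_def)
  have sq: "x \<in> J" if "x ^ n \<in> J" for x n
    by (subst closed[symmetric]) (use that in blast)
  define T where "T = {ideal_quot J {g * h} | h. g * h \<notin> J}"
  \<comment> \<open>Reverse inclusion: well-foundedness is then the chain condition, and a minimal
    element is a maximal quotient.\<close>
  define R where "R = {(B :: 'a set, A). ring_ideal.subspace A \<and> ring_ideal.subspace B \<and> A \<subset> B}"
  have "wf R"
    unfolding wf_iff_no_infinite_down_chain
  proof
    assume "\<exists>I. \<forall>k. (I (Suc k), I k) \<in> R"
    then obtain I where "\<And>k. (I (Suc k), I k) \<in> R"
      by blast
    then show False
      using acc[of I] by (simp add: R_def)
  qed
  moreover have "ideal_quot J {g * 1} \<in> T"
    unfolding T_def using g by (intro CollectI exI[of _ 1]) simp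
  ultimately obtain Q where "Q \<in> T" and max: "\<And>B. (B, Q) \<in> R \<Longrightarrow> B \<notin> T"
    by (rule wfE_min) blast
  then obtain h where h: "Q = ideal_quot J {g * h}" "g * h \<notin> J"
    unfolding T_def by blast
  have Q: "ring_ideal.subspace Q"
    using J h by (simp add: subspace_ideal_quot)
  have "a \<in> Q" if "a * b \<in> Q" "b \<notin> Q" for a b
  proof -
    \<comment> \<open>Passing from \<open>h\<close> to \<open>h * b\<close> enlarges the quotient
      but stays in \<open>T\<close> because \<open>b\<close> is outside \<open>Q\<close>; maximality
      gives equality.\<close>
    let ?B = "ideal_quot J {g * (h * b)}"
    have "x \<in> ?B" if "x \<in> Q" for x
      using ring_ideal.subspace_scale[OF J, of "x * (g * h)" b] that by (simp add: h ac_simps)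
    then have "Q \<subseteq> ?B"
      by blast
    moreover have "g * (h * b) \<notin> J"
      using that by (simp add: h ac_simps)
    then have "?B \<in> T"
      unfolding T_def by blast
    ultimately have "?B = Q"
      using max[of ?B] Q subspace_ideal_quot[OF J, of "{g * (h * b)}"] unfolding R_def by blast
    moreover have "a \<in> ?B"
      using that by (simp add: h ac_simps)
    ultimately show ?thesis
      by blast
  qed
  moreover have "1 \<notin> Q"
    using h by simp
  ultimately have "prime_ideal Q"
    using Q unfolding prime_ideal_def by (metis UNIV_I)
  then have "Q \<in> Ass J"
    using h(1) unfolding Ass_def by blast
  moreover have "g \<notin> Q"
  proof
    assume "g \<in> Q"
    \<comment> \<open>This element is \<open>(g * h) ^ 2\<close>, so radicality would put
      \<open>g * h\<close> into \<open>J\<close>.\<close>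
    then have "h * (g * (g * h)) \<in> J"
      using ring_ideal.subspace_scale[OF J, of "g * (g * h)" h] by (simp add: h)
    then show False
      using sq[of "g * h" 2] h by (simp add: power2_eq_square ac_simps)
  qed
  ultimately show ?thesis
    by blast
qed

text \<open>Each associated prime has the form \<open>(J : f)\<close> and so contains
  \<open>J\<close>. For \<open>J = UNIV\<close> there are none, and the empty intersection is
  \<open>UNIV\<close>.\<close>

lemma radical_ideal_eq_Inter_Ass:
  fixes J :: "'a::comm_ring_1 set"
  assumes acc: "\<And>I :: nat \<Rightarrow> 'a set.
      (\<And>k. ring_ideal.subspace (I k)) \<Longrightarrow> (\<And>k. I k \<subset> I (Suc k)) \<Longrightarrow> False"
    and rad: "radical_ideal J"
  shows "J = \<Inter> (Ass J)"
proof
  have "ring_ideal.subspace J"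
    using rad by (simp add: radical_ideal_def)
  then have "x * f \<in> J" if "x \<in> J" for x f
    using ring_ideal.subspace_scale[of J x f] that by (simp add: mult.commute)
  then show "J \<subseteq> \<Inter> (Ass J)"
    by (auto simp: Ass_def)
  have "\<exists>Q\<in>Ass J. g \<notin> Q" if "g \<notin> J" for g
    by (rule radical_ideal_Ass[OF _ rad that]) (rule acc)
  then show "\<Inter> (Ass J) \<subseteq> J"
    by blast
qed

lemma prime_ideal_prod:
  assumes P: "prime_ideal P" and "finite L" "(\<Prod>l\<in>L. a l) \<in> P"
  shows "\<exists>l\<in>L. a l \<in> P"
  using assms(2,3)
proof (induction L rule: finite_induct)
  case empty
  then have "x \<in> P" for x
    using P ring_ideal.subspace_scale[of P 1 x] by (simp add: prime_ideal_def)
  then show ?case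
    using P by (auto simp: prime_ideal_def)
qed (use P in \<open>auto simp: prime_ideal_def\<close>)

text \<open>An associated prime \<open>(J : f)\<close> of a quotient \<open>J = (I : L)\<close> is the finite intersection of the
  ideals \<open>(I : f l)\<close>, hence equal to one of them.\<close>

lemma Ass_ideal_quot_subset:
  assumes I: "ring_ideal.subspace I" and L: "finite L" and J: "J = ideal_quot I L"
  shows "Ass J \<subseteq> Ass I"
proof
  fix Q
  assume "Q \<in> Ass J"
  then obtain f where Q: "prime_ideal Q" "Q = ideal_quot J {f}"
    by (auto simp: Ass_def)
  have eq: "x \<in> Q \<longleftrightarrow> (\<forall>l\<in>L. x * (f * l) \<in> I)" for x
    by (simp add: Q J ideal_quot_def mult.assoc)
  have "\<exists>l\<in>L. ideal_quot I {f * l} \<subseteq> Q"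
  proof (rule ccontr)
    assume "\<not> ?thesis"
    then have "\<forall>l\<in>L. \<exists>x. x * (f * l) \<in> I \<and> x \<notin> Q"
      by fastforce
    then obtain a where a: "\<And>l. l \<in> L \<Longrightarrow> a l * (f * l) \<in> I \<and> a l \<notin> Q"
      by metis
    \<comment> \<open>The product of all \<open>a l\<close> multiplies every \<open>f * l\<close>
      into \<open>I\<close>, hence lies in the prime \<open>Q\<close>, which contains none of the
      factors.\<close>
    have "(\<Prod>l\<in>L. a l) * (f * l) \<in> I" if "l \<in> L" for l
    proof -
      have "(\<Prod>l\<in>L. a l) * (f * l) = (\<Prod>l\<in>L - {l}. a l) * (a l * (f * l))"
        by (simp add: prod.remove[OF L that] ac_simps)
      then show ?thesis
        using ring_ideal.subspace_scale[OF I, of "a l * (f * l)"] a[OF that] by simp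
    qed
    then show False
      using prime_ideal_prod[OF Q(1) L] a eq by blast
  qed
  then obtain l where "l \<in> L" "ideal_quot I {f * l} \<subseteq> Q"
    by blast
  then have "Q = ideal_quot I {f * l}"
    using eq by auto
  then show "Q \<in> Ass I"
    using Q(1) by (auto simp: Ass_def)
qed

text \<open>If \<open>P = (I : f)\<close> belongs to \<open>T\<close>, then \<open>f\<close> lies in
  \<open>(I : \<Inter> T)\<close>; so every element of the double quotient multiplies
  \<open>f\<close> into \<open>I\<close>.\<close>

lemma ideal_quot_quot_Inter_subset:
  assumes "T \<subseteq> Ass I"
  shows "ideal_quot I (ideal_quot I (\<Inter> T)) \<subseteq> \<Inter> T"
proof (intro subsetI InterI)
  fix g P
  assume g: "g \<in> ideal_quot I (ideal_quot I (\<Inter> T))" and P: "P \<in> T"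
  then obtain f where f: "P = ideal_quot I {f}"
    using assms by (auto simp: Ass_def)
  have "f \<in> ideal_quot I (\<Inter> T)"
    using P by (auto simp: f ideal_quot_def mult.commute)
  then show "g \<in> P"
    using g by (auto simp: f ideal_quot_def)
qed


subsection \<open>Reduction modulo p\<close>

lemma local_rats_cases:
  assumes "x \<in> local_rats p"
  obtains a b where "x = of_int a / of_int b" "\<not> int p dvd b" "b \<noteq> 0"
  using assms unfolding local_rats_def by fastforce

lemma not_dvd_mult:
  assumes "\<not> int CARD('p::prime_card) dvd a" "\<not> int CARD('p) dvd b"
  shows "\<not> int CARD('p) dvd a * b"
  using assms prime_card[where 'a = 'p] by (simp add: prime_dvd_mult_iff)

lemma of_int_mod_ring_eq_0:
  "(of_int x :: 'p::prime_card mod_ring) = 0 \<longleftrightarrow> int CARD('p) dvd x"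
  by (simp add: of_int_eq_0_iff_char_dvd)

lemma
  fixes x y :: rat
  assumes "x \<in> local_rats CARD('p::prime_card)" "y \<in> local_rats CARD('p)"
  shows local_rats_mult: "x * y \<in> local_rats CARD('p)"
    and red_mult: "(red (x * y) :: 'p mod_ring) = red x * red y"
    and local_rats_add: "x + y \<in> local_rats CARD('p)"
    and red_add: "(red (x + y) :: 'p mod_ring) = red x + red y"
    and local_rats_diff: "x - y \<in> local_rats CARD('p)"
proof -
  obtain a b where x: "x = of_int a / of_int b" "\<not> int CARD('p) dvd b" "b \<noteq> 0"
    using assms(1) by (rule local_rats_cases)
  obtain c d where y: "y = of_int c / of_int d" "\<not> int CARD('p) dvd d" "d \<noteq> 0"
    using assms(2) by (rule local_rats_cases)
  have bd: "\<not> int CARD('p) dvd b * d"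
    using x y by (simp add: not_dvd_mult)
  have nz: "(of_int b :: 'p mod_ring) \<noteq> 0" "(of_int d :: 'p mod_ring) \<noteq> 0"
    using x y by (simp_all only: of_int_mod_ring_eq_0 not_False_eq_True)
  have m: "x * y = of_int (a * c) / of_int (b * d)"
    using x y by simp
  have p: "x + y = of_int (a * d + c * b) / of_int (b * d)"
    unfolding x(1) y(1) using x(3) y(3) by (simp add: add_frac_eq)
  have "x - y = of_int (a * d - c * b) / of_int (b * d)"
    unfolding x(1) y(1) using x(3) y(3) by (simp add: diff_frac_eq)
  with m p bd show "x * y \<in> local_rats CARD('p)" "x + y \<in> local_rats CARD('p)"
      "x - y \<in> local_rats CARD('p)"
    unfolding local_rats_def by blast+
  show "(red (x * y) :: 'p mod_ring) = red x * red y"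
    unfolding m red_of_int_divide[OF bd] unfolding x(1) y(1) red_of_int_divide[OF x(2)]
      red_of_int_divide[OF y(2)] by simp
  show "(red (x + y) :: 'p mod_ring) = red x + red y"
    unfolding p red_of_int_divide[OF bd] unfolding x(1) y(1) red_of_int_divide[OF x(2)]
      red_of_int_divide[OF y(2)] by (simp add: add_frac_eq[OF nz])
qed

lemma red_0 [simp]: "red 0 = 0"
  and red_1 [simp]: "red 1 = 1"
  by (simp_all add: red_def)

lemma local_rats_0 [simp]: "0 \<in> local_rats CARD('p::prime_card)"
  and local_rats_1 [simp]: "1 \<in> local_rats CARD('p)"
proof -
  have "\<not> int CARD('p) dvd 1"
    using of_int_mod_ring_eq_0[of 1, where 'p = 'p] by simp
  then have "of_int a / of_int 1 \<in> local_rats CARD('p)" for a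
    unfolding local_rats_def by blast
  from this[of 0] this[of 1] show "0 \<in> local_rats CARD('p)" "1 \<in> local_rats CARD('p)"
    by simp_all
qed

lemma inverse_local_rats:
  assumes "x \<in> local_rats CARD('p::prime_card)" "(red x :: 'p mod_ring) \<noteq> 0"
  shows "inverse x \<in> local_rats CARD('p)"
proof -
  obtain a b where x: "x = of_int a / of_int b" "\<not> int CARD('p) dvd b" "b \<noteq> 0"
    using assms(1) by (rule local_rats_cases)
  have "(of_int a :: 'p mod_ring) \<noteq> 0"
    using assms(2) by (auto simp: x red_of_int_divide[OF x(2)])
  then have "\<not> int CARD('p) dvd a"
    by (simp only: of_int_mod_ring_eq_0 not_False_eq_True)
  moreover have "inverse x = of_int b / of_int a"
    by (simp add: x)
  ultimately show ?thesis
    unfolding local_rats_def by blast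
qed

text \<open>In lowest terms \<open>p\<close> cannot divide both numerator and denominator: the local
  ring is a valuation ring.\<close>

lemma local_rats_valuation:
  "x \<in> local_rats CARD('p::prime_card) \<or> inverse x \<in> local_rats CARD('p)"
proof -
  obtain a b where q: "quotient_of x = (a, b)"
    by (meson surj_pair)
  have "coprime a b" and x: "x = of_int a / of_int b"
    using q quotient_of_coprime quotient_of_div by blast+
  then have "\<not> int CARD('p) dvd b \<or> \<not> int CARD('p) dvd a"
    using prime_card[where 'a = 'p] by (metis coprime_common_divisor not_prime_unit prime_nat_int_transfer)
  moreover have "inverse x = of_int b / of_int a"
    by (simp add: x)
  ultimately show ?thesis
    unfolding local_rats_def using x by blast
qed

lemma lookup_local: "f \<in> local_polys p \<Longrightarrow> Poly_Mapping.lookup f t \<in> local_rats p"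
  by (simp add: local_polys_def)

lemma
  fixes f g :: "('x, rat) mpoly"
  assumes "f \<in> local_polys CARD('p::prime_card)" "g \<in> local_polys CARD('p)"
  shows local_polys_add: "f + g \<in> local_polys CARD('p)"
    and phi_add: "(phi (f + g) :: ('x, 'p mod_ring) mpoly) = phi f + phi g"
  using assms
  by (auto simp: local_polys_def lookup_add local_rats_add lookup_phi red_add intro!: poly_mapping_eqI)

lemma phi_0 [simp]: "phi 0 = 0"
  and phi_1 [simp]: "phi 1 = 1"
  by (auto simp: lookup_phi lookup_one when_def intro!: poly_mapping_eqI)

lemma local_polys_1 [simp]: "1 \<in> local_polys CARD('p::prime_card)"
  by (simp add: local_polys_def lookup_one when_def)

lemma
  fixes g :: "('x, rat) mpoly"
  assumes "a \<in> local_rats CARD('p::prime_card)" "g \<in> local_polys CARD('p)"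
  shows local_polys_single_times: "Poly_Mapping.single u a * g \<in> local_polys CARD('p)"
    and phi_single_times:
      "(phi (Poly_Mapping.single u a * g) :: ('x, 'p mod_ring) mpoly) =
        Poly_Mapping.single u (red a) * phi g"
proof -
  have *: "Poly_Mapping.lookup (Poly_Mapping.single u a * g) t \<in> local_rats CARD('p) \<and>
    (red (Poly_Mapping.lookup (Poly_Mapping.single u a * g) t) :: 'p mod_ring) =
      Poly_Mapping.lookup (Poly_Mapping.single u (red a) * phi g) t" for t
  proof (cases "\<exists>s. t = u + s")
    case True
    then obtain s where s: "t = u + s"
      by blast
    show ?thesis
      using local_rats_mult[OF assms(1) lookup_local[OF assms(2)]]
        red_mult[OF assms(1) lookup_local[OF assms(2)]]
      by (simp add: s lookup_single_times_add lookup_phi)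
  qed (simp add: lookup_single_times_other)
  show "Poly_Mapping.single u a * g \<in> local_polys CARD('p)"
    using * by (simp add: local_polys_def)
  show "(phi (Poly_Mapping.single u a * g) :: ('x, 'p mod_ring) mpoly) =
        Poly_Mapping.single u (red a) * phi g"
    by (rule poly_mapping_eqI) (simp add: lookup_phi *)
qed

lemma
  fixes g :: "('x, rat) mpoly"
  assumes f: "f \<in> local_polys CARD('p::prime_card)" and g: "g \<in> local_polys CARD('p)"
  shows local_polys_mult: "f * g \<in> local_polys CARD('p)"
    and phi_mult: "(phi (f * g) :: ('x, 'p mod_ring) mpoly) = phi f * phi g"
proof -
  let ?m = "\<lambda>k. Poly_Mapping.single k (Poly_Mapping.lookup f k)"
  \<comment> \<open>Stated for arbitrary \<open>h\<close>: taking \<open>h = 1\<close> expands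
    \<open>phi f\<close>, and \<open>h = g\<close> then gives the product.\<close>
  have *: "(\<Sum>k\<in>K. ?m k) * h \<in> local_polys CARD('p) \<and>
      (phi ((\<Sum>k\<in>K. ?m k) * h) :: ('x, 'p mod_ring) mpoly) =
        (\<Sum>k\<in>K. Poly_Mapping.single k (red (Poly_Mapping.lookup f k))) * phi h"
    if "h \<in> local_polys CARD('p)" "finite K" for K h
    using that(2)
  proof (induction K rule: finite_induct)
    case empty
    then show ?case
      by (simp add: local_polys_def)
  next
    case (insert k K)
    then show ?case
      using local_polys_single_times[OF lookup_local[OF f] that(1)]
        phi_single_times[OF lookup_local[OF f] that(1)]
      by (simp add: distrib_right local_polys_add phi_add)
  qed
  have phi_f: "(phi f :: ('x, 'p mod_ring) mpoly) =
      (\<Sum>k\<in>Poly_Mapping.keys f. Poly_Mapping.single k (red (Poly_Mapping.lookup f k)))"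
    using *[OF local_polys_1 finite_keys[of f]] by (simp add: sum_single_lookup)
  show "f * g \<in> local_polys CARD('p)"
    using *[OF g finite_keys[of f]] by (simp add: sum_single_lookup)
  show "(phi (f * g) :: ('x, 'p mod_ring) mpoly) = phi f * phi g"
    using *[OF g finite_keys[of f]] by (simp add: sum_single_lookup phi_f)
qed

text \<open>Divide by a coefficient of least \<open>p\<close>-adic valuation, found by comparing
  coefficients with \<open>local_rats_valuation\<close>; it becomes \<open>1\<close> and survives
  reduction.\<close>

lemma exists_primitive_multiple:
  fixes f :: "('x, rat) mpoly"
  assumes "f \<noteq> 0"
  shows "\<exists>c. Poly_Mapping.single 0 c * f \<in> local_polys CARD('p::prime_card) \<and>
    (phi (Poly_Mapping.single 0 c * f) :: ('x, 'p mod_ring) mpoly) \<noteq> 0"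
proof -
  have "\<exists>t\<in>T. \<forall>s\<in>T. Poly_Mapping.lookup f s / Poly_Mapping.lookup f t \<in> local_rats CARD('p)"
    if "finite T" "T \<noteq> {}" "T \<subseteq> Poly_Mapping.keys f" for T
    using that
  proof (induction T rule: finite_ne_induct)
    case (singleton x)
    then show ?case
      by (simp add: in_keys_iff)
  next
    case (insert x T)
    let ?l = "Poly_Mapping.lookup f"
    obtain t where t: "t \<in> T" "\<forall>s\<in>T. ?l s / ?l t \<in> local_rats CARD('p)"
      using insert by auto
    show ?case
    proof (cases "?l x / ?l t \<in> local_rats CARD('p)")
      case True
      then show ?thesis
        using t by blast
    next
      case False
      then have x: "?l t / ?l x \<in> local_rats CARD('p)"
        using local_rats_valuation[of "?l x / ?l t", where 'p = 'p] by simp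
      have nz: "?l x \<noteq> 0" "?l t \<noteq> 0"
        using insert.prems t(1) by (auto simp: in_keys_iff)
      have "?l s / ?l x \<in> local_rats CARD('p)" if "s \<in> T" for s
        using local_rats_mult[OF t(2)[rule_format, OF that] x] nz by simp
      then show ?thesis
        using nz by (intro bexI[of _ x]) auto
    qed
  qed
  moreover have "Poly_Mapping.keys f \<noteq> {}"
    using assms by simp
  ultimately obtain t where t: "t \<in> Poly_Mapping.keys f"
    "\<forall>s\<in>Poly_Mapping.keys f. Poly_Mapping.lookup f s / Poly_Mapping.lookup f t \<in> local_rats CARD('p)"
    by (meson finite_keys order_refl)
  define c where "c = inverse (Poly_Mapping.lookup f t)"
  have "Poly_Mapping.lookup (Poly_Mapping.single 0 c * f) s \<in> local_rats CARD('p)" for s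
    using t(2) by (cases "s \<in> Poly_Mapping.keys f")
      (auto simp: scalar_times c_def in_keys_iff divide_inverse_commute)
  moreover have "Poly_Mapping.lookup (phi (Poly_Mapping.single 0 c * f) :: ('x, 'p mod_ring) mpoly) t = 1"
    using t(1) by (simp add: lookup_phi scalar_times c_def in_keys_iff)
  ultimately show ?thesis
    unfolding local_polys_def by (intro exI[of _ c]) auto
qed

lemma keys_phi: "Poly_Mapping.keys (phi f) \<subseteq> Poly_Mapping.keys f"
  by (auto simp: in_keys_iff lookup_phi)

text \<open>Reduction can only delete keys, and the leading one survives.\<close>

lemma lpp_phi:
  fixes f :: "('x, rat) mpoly"
  assumes ord: "monomial_ordering r" and lc: "(red (lc r f) :: 'p::prime_card mod_ring) \<noteq> 0"
  shows "lpp r (phi f :: ('x, 'p mod_ring) mpoly) = lpp r f"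
proof (rule lpp_eqI[OF ord])
  show "lpp r f \<in> Poly_Mapping.keys (phi f :: ('x, 'p mod_ring) mpoly)"
    using lc by (simp add: in_keys_iff lookup_phi lc_def)
  have "f \<noteq> 0"
    using lc by (auto simp: lc_def)
  then show "(s, lpp r f) \<in> r" if "s \<in> Poly_Mapping.keys (phi f :: ('x, 'p mod_ring) mpoly)" for s
    using lpp_max[OF ord] that keys_phi[of f] by blast
qed

text \<open>Since the leading coefficients of \<open>F\<close> are units of \<open>\<int>\<^bsub>(p)\<^esub>\<close>, division by \<open>F\<close> stays over
  \<open>\<int>\<^bsub>(p)\<^esub>\<close>.\<close>

lemma phi_in_ideal_mod:
  fixes I :: "('x, rat) mpoly set"
  assumes ord: "monomial_ordering r" and I: "ring_ideal.subspace I"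
    and F: "groebner_basis r F I" "permissible TYPE('p::prime_card) r F"
    and f: "f \<in> I" "f \<in> local_polys CARD('p)"
  shows "(phi f :: ('x, 'p mod_ring) mpoly) \<in> ideal_mod F"
proof -
  \<comment> \<open>The accumulated combination carries its reduction along; the remainder vanishes
    in the end, so \<open>f\<close> is that combination.\<close>
  let ?Q = "\<lambda>q. q \<in> I \<and> q \<in> local_polys CARD('p) \<and>
    (phi q :: ('x, 'p mod_ring) mpoly) \<in> ideal_mod F"
  have local: "F \<subseteq> local_polys CARD('p)" and FI: "F \<subseteq> I"
    and unit: "\<And>g. g \<in> F \<Longrightarrow> (red (lc r g) :: 'p mod_ring) \<noteq> 0"
    using F by (auto simp: permissible_def groebner_basis_def)
  have "\<exists>q. ?Q q \<and> normal_form r F (f - q)"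
  proof (rule division[OF ord, where A = "local_rats CARD('p)"])
    show "inverse (lc r g) \<in> local_rats CARD('p)" if "g \<in> F" for g
      using inverse_local_rats[OF _ unit[OF that]] that local
      by (auto simp: lc_def intro: lookup_local)
    show "?Q (Poly_Mapping.single u a * g)" if "a \<in> local_rats CARD('p)" "g \<in> F" for u a g
    proof -
      have "g \<in> local_polys CARD('p)" "g \<in> I"
        using that local FI by blast+
      then show ?thesis
        using that I by (simp add: local_polys_single_times phi_single_times ideal_mod_def
            ring_ideal.subspace_scale ring_ideal.span_scale ring_ideal.span_base)
    qed
    show "?Q 0"
      using I by (simp add: ideal_mod_def ring_ideal.subspace_0 ring_ideal.span_zero local_polys_def)
    show "?Q (x + y)" if "?Q x" "?Q y" for x y
      using that I by (simp add: local_polys_add phi_add ideal_mod_def ring_ideal.subspace_add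
          ring_ideal.span_add)
    show "Poly_Mapping.lookup g t \<in> local_rats CARD('p)" if "g \<in> F" for g t
      using that local lookup_local by blast
  qed (simp_all add: local_rats_mult local_rats_diff lookup_local[OF f(2)])
  then obtain q where q: "?Q q" "normal_form r F (f - q)"
    by blast
  have "f - q \<in> I"
    using f q I by (auto intro: ring_ideal.subspace_diff)
  then have "f = q"
    using normal_form_in_ideal[OF ord F(1) _ q(2)] by simp
  then show ?thesis
    using q by simp
qed

text \<open>The normal form of an element of \<open>M\<close>, scaled to be nonzero modulo \<open>p\<close>, would have a reduction whose
  leading power product is divisible by that of some element of \<open>\<phi>\<^sub>p(H)\<close>.\<close>

lemma subset_span_of_reduction:
  fixes M H :: "('x, rat) mpoly set"
  assumes ord: "monomial_ordering r" and M: "ring_ideal.subspace M" "H \<subseteq> M"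
    and H: "permissible TYPE('p::prime_card) r H"
    and gb: "groebner_basis r (phi ` H :: ('x, 'p mod_ring) mpoly set) K"
    and red: "\<And>f. f \<in> M \<Longrightarrow> f \<in> local_polys CARD('p) \<Longrightarrow> phi f \<in> K"
  shows "M \<subseteq> ring_ideal.span H"
proof
  fix f
  assume "f \<in> M"
  obtain q where q: "q \<in> ring_ideal.span H" "normal_form r H (f - q)"
    using division_field[OF ord] by blast
  have "q \<in> M"
    using q(1) M by (meson ring_ideal.span_minimal subsetD)
  then have M': "f - q \<in> M"
    using \<open>f \<in> M\<close> M(1) by (auto intro: ring_ideal.subspace_diff)
  have "f - q = 0"
  proof (rule ccontr)
    assume "f - q \<noteq> 0"
    then obtain c where c: "Poly_Mapping.single 0 c * (f - q) \<in> local_polys CARD('p)"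
      and nz: "(phi (Poly_Mapping.single 0 c * (f - q)) :: ('x, 'p mod_ring) mpoly) \<noteq> 0"
      using exists_primitive_multiple by blast
    let ?g = "phi (Poly_Mapping.single 0 c * (f - q)) :: ('x, 'p mod_ring) mpoly"
    have "?g \<in> K"
      using red[OF ring_ideal.subspace_scale[OF M(1) M'] c] .
    then obtain h u where h: "h \<in> H" "lpp r ?g = lpp r (phi h :: ('x, 'p mod_ring) mpoly) + u"
      using groebner_basis_lpp[OF ord gb _ nz] by blast
    have unit: "(red (lc r h) :: 'p mod_ring) \<noteq> 0"
      using H h by (simp add: permissible_def)
    then have "h \<noteq> 0"
      by (auto simp: lc_def)
    moreover have "lpp r ?g = lpp r h + u"
      using h lpp_phi[OF ord unit] by simp
    \<comment> \<open>Neither scaling nor reduction creates keys, so this power product already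
      occurs in the normal form \<open>f - q\<close>.\<close>
    moreover have "lpp r ?g \<in> Poly_Mapping.keys (f - q)"
      using subsetD[OF keys_phi lpp_in_keys[OF ord nz]] by (auto simp: in_keys_iff scalar_times)
    ultimately show False
      using q(2) h(1) unfolding normal_form_def by blast
  qed
  then show "f \<in> ring_ideal.span H"
    using q by simp
qed

section \<open>Recovering \<open>J\<close> as a quotient of \<open>I\<close>\<close>

lemma subspace_Ass: "P \<in> Ass I \<Longrightarrow> ring_ideal.subspace P"
  by (simp add: Ass_def prime_ideal_def)

text \<open>The set found is \<open>Ass J\<close>. Asking for \<open>S \<noteq> {}\<close> rules out
  the empty intersection \<open>UNIV\<close>.\<close>

theorem proposition2p3p4:
  fixes r :: "('x::finite) pp rel"
    and F Hcan L I J :: "('x, rat) mpoly set"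
    and U :: "'x set"
    and Hbar Jbar :: "('x, 'p::prime_card mod_ring) mpoly set"
  assumes "monomial_ordering r"
    and "ring_ideal.subspace I"
    and "groebner_basis r F I"
    and "permissible TYPE('p) r F"
    and "Ass_MIS U (ideal_mod F :: ('x, 'p mod_ring) mpoly set) \<noteq> {}"
    and "Jbar = \<Inter> (Ass_MIS U (ideal_mod F))"
    and "groebner_basis r Hbar Jbar"
    and "finite Hcan"
    and "phi ` Hcan = Hbar"
    and "J = ring_ideal.span Hcan"
    and "permissible TYPE('p) r Hcan"
    and "groebner_basis r Hcan J"
    and "reduced_groebner_basis r L (ideal_quot I J)"
    and "effectively_lucky TYPE('p) r L"
    and "(ideal_mod L :: ('x, 'p mod_ring) mpoly set) = ideal_quot (ideal_mod F) (ideal_mod Hcan)"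
    and "radical_ideal J"
  shows "\<exists>S. S \<noteq> {} \<and> S \<subseteq> Ass I \<and> J = \<Inter> S"
proof -
  note ord = assms(1)
  let ?Ibar = "ideal_mod F :: ('x, 'p mod_ring) mpoly set"
  let ?M = "ideal_quot I (ideal_quot I J)"
  have J: "ring_ideal.subspace J"
    using assms(10) by simp
  have T: "Ass_MIS U ?Ibar \<subseteq> Ass ?Ibar"
    by (auto simp: Ass_MIS_def)
  have Jbar: "ring_ideal.subspace Jbar"
    unfolding assms(6) by (rule ring_ideal.subspace_Inter) (use T subspace_Ass in blast)
  have Hbar: "ideal_mod Hcan = Jbar"
    using groebner_basis_span[OF ord Jbar assms(7)] by (simp add: ideal_mod_def assms(9))
  have quot: "ring_ideal.subspace (ideal_quot I J)"
    using assms(2) by (rule subspace_ideal_quot)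
  have L: "finite L" "groebner_basis r L (ideal_quot I J)"
    using assms(13) by (auto simp: reduced_groebner_basis_def groebner_basis_def)
  have spanL: "ring_ideal.span L = ideal_quot I J"
    by (rule groebner_basis_span[OF ord quot L(2)])
  obtain G where G: "reduced_groebner_basis r G (ring_ideal.span L)" "permissible TYPE('p) r G"
    using assms(14) by (auto simp: effectively_lucky_def)
  \<comment> \<open>Uniqueness of reduced bases transfers the \<open>p\<close>-integrality of
    \<open>G\<close> to \<open>L\<close>.\<close>
  have "L \<subseteq> G"
    using reduced_groebner_basis_subset[OF ord quot assms(13)] G(1) by (simp add: spanL)
  then have localL: "L \<subseteq> local_polys CARD('p)"
    using G(2) by (auto simp: permissible_def)
  have LI: "l * f \<in> I" if "f \<in> ideal_quot I L" "l \<in> L" for f l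
    using that unfolding ideal_quot_def mult.commute[of l] by blast
  \<comment> \<open>A quotient by an ideal is determined by generators; the finite set
    \<open>L\<close> is what \<open>Ass_ideal_quot_subset\<close> asks for.\<close>
  have M_eq: "?M = ideal_quot I L"
  proof
    show "?M \<subseteq> ideal_quot I L"
      using L(2) by (auto simp: ideal_quot_def groebner_basis_def)
    show "ideal_quot I L \<subseteq> ?M"
    proof
      fix f
      assume f: "f \<in> ideal_quot I L"
      have "ring_ideal.span L \<subseteq> ideal_quot I {f}"
        using LI[OF f] by (intro ring_ideal.span_minimal subspace_ideal_quot assms(2)) auto
      then show "f \<in> ?M"
        by (auto simp: spanL ideal_quot_def mult.commute)
    qed
  qed
  have red_M: "phi f \<in> Jbar" if f: "f \<in> ?M" "f \<in> local_polys CARD('p)" for f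
  proof -
    have "phi l * phi f \<in> ?Ibar" if "l \<in> L" for l
    proof -
      have l: "l \<in> local_polys CARD('p)"
        using localL that by blast
      have "l * f \<in> I"
        using f(1) that unfolding M_eq by (rule LI)
      then show ?thesis
        using phi_in_ideal_mod[OF ord assms(2-4) _ local_polys_mult[OF l f(2)]]
          phi_mult[OF l f(2)] by simp
    qed
    \<comment> \<open>The \<open>phi l\<close> generate \<open>ideal_mod L\<close>, which is
      \<open>(?Ibar : Jbar)\<close>; so \<open>phi f\<close> lies in the double quotient, which is
      inside \<open>Jbar\<close>.\<close>
    then have "ideal_mod L \<subseteq> ideal_quot ?Ibar {phi f}"
      unfolding ideal_mod_def[of L]
      by (intro ring_ideal.span_minimal subspace_ideal_quot) (auto simp: ideal_mod_def)
    then have "phi f \<in> ideal_quot ?Ibar (ideal_mod L)"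
      by (auto simp: ideal_quot_def mult.commute)
    then show ?thesis
      using ideal_quot_quot_Inter_subset[OF T] unfolding assms(15) Hbar assms(6)
      by (auto simp: ideal_mod_def)
  qed
  have JM: "J \<subseteq> ?M"
    by (auto simp: ideal_quot_def mult.commute)
  have Hcan: "Hcan \<subseteq> J"
    using assms(10) by (simp add: ring_ideal.span_superset)
  have "?M \<subseteq> J"
    unfolding assms(10)
    by (rule subset_span_of_reduction[OF ord _ _ assms(11)])
      (use assms(2,7,9) red_M JM Hcan in \<open>auto simp: subspace_ideal_quot assms(10)\<close>)
  then have "J = ideal_quot I L"
    using JM M_eq by blast
  then have "Ass J \<subseteq> Ass I"
    by (rule Ass_ideal_quot_subset[OF assms(2) L(1)])
  moreover have eq: "J = \<Inter> (Ass J)"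
    using no_ascending_chain[OF ord] assms(16) by (rule radical_ideal_eq_Inter_Ass)
  \<comment> \<open>Otherwise \<open>1\<close> would lie in \<open>J\<close> and hence in
    \<open>Jbar\<close>, but \<open>Jbar\<close> is contained in a proper prime because
    \<open>Ass_MIS U ?Ibar\<close> is nonempty.\<close>
  moreover have "Ass J \<noteq> {}"
  proof
    assume "Ass J = {}"
    then have "J = UNIV"
      using eq by simp
    then have "?M = UNIV"
      using JM by blast
    then have "1 \<in> Jbar"
      using red_M[of 1] by simp
    then have "Jbar = UNIV"
      using ring_ideal.subspace_scale[OF Jbar, of 1] by auto
    then show False
      using assms(5) T unfolding assms(6) Ass_def prime_ideal_def by blast
  qed
  ultimately show ?thesis
    by blast
qed

end
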